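(* Let $k>2$ and let $\mathbf{P}$ be a probability distribution on $\mathbb{Z}_{\ge 0}^k$ such that $\mathbf{P}(n^+)>0$ for all $n$. Assume that there is a function $q:\{1,\dots,k\}\times([0,1]\cap\mathbb{Q})\to[0,1]$ such that for every $n=(n_1,\dots,n_k)\in\mathbb{Z}_{\ge 0}^k$ with $n\neq 0$ and every $j\in\{1,\dots,k\}$, $$\mathbf{P}\big((n+e_j)^+\,\big|\,n^+\big)=q\Big(j,\frac{n_j}{n_1+\cdots+n_k}\Big).\qquad( * )$$ Then for every $j$ and all integers $1\le m\le l$, $$q\Big(j,\frac{m}{l}\Big)=q(j,1)=:q_j .$$ Moreover, writing $q_{0j}:=q(j,0)$ and $I=I(n)=\{j:n_j\ne 0\}$, there is a constant $\omega>0$ such that for all $n$ with $n_1+\cdots+n_k>0$, $$\mathbf{P}\big((n_1,\dots,n_k)^+\big)=\omega\prod_{j\in I}\big[q_{0j}\,q_j^{\,n_j-1}\big],$$ $$\mathbf{P}(n_1,\dots,n_k)=\prod_{j\in I}(1-q_j)\prod_{j\notin I}(1-q_{0j})\;\mathbf{P}\big((n_1,\dots,n_k)^+\big),$$ and $$\mathbf{P}(0,\dots,0)=1-\omega\Big[1-\prod_{j=1}^k(1-q_{0j})\Big].$$ Here $q_j\in(0,1)$, $q_{0j}\in(0,1]$ ($j=1,\dots,k$) and $\omega>0$ are arbitrary constants subject to the constraint $\mathbf{P}(0,\dots,0)\ge 0$, that is, $$\omega\Big[1-\prod_{j=1}^k(1-q_{0j})\Big]\le 1 .$$ In other words, the constants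 arising from any such $\mathbf{P}$ satisfy these restrictions, and conversely every choice of constants satisfying them defines, by the formulas above, a probability distribution satisfying $( * )$ with $q(j,x)=q_j$ for $x\neq 0$ and $q(j,0)=q_{0j}$. In particular, $\omega\le 1$ if $q_{0j}=1$ for at least one index $j$.
   Context: $\mathbb{Z}_{\ge 0}^k$ is the set of vectors $n=(n_1,\dots,n_k)$ of non-negative integers ($n_j$ is the number of particles in state $j$). $\mathbf{P}(n)=\mathbf{P}(n_1,\dots,n_k)$ denotes the probability of the single point $n$. The vector $e_j$ is the $j$th unit coordinate vector (with $j$th coordinate $1$ and all other coordinates $0$). For $n\in\mathbb{Z}_{\ge 0}^k$, $n^+=(n_1,\dots,n_k)^+$ denotes the event $\{m\in\mathbb{Z}_{\ge 0}^k : m_j\ge n_j \text{ for all } j=1,\dots,k\}$. $\mathbf{P}(A|B)=\mathbf{P}(A\cap B)/\mathbf{P}(B)$ is the usual conditional probability. *)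

theory Defs
  imports "HOL-Probability.Probability"
begin

text \<open>
  The set of states is the finite type \<open>'k\<close>, so \<open>k\<close> is \<open>CARD('k)\<close>, and occupation vectors are
  elements of \<open>nat ^ 'k\<close>; the unit vector of state \<open>j\<close> is \<open>axis j 1\<close>.  As \<open>nat ^ 'k\<close> is countable,
  its probability distributions are exactly the elements of \<open>(nat ^ 'k) pmf\<close>.
\<close>

definition up_set :: "nat ^ 'k \<Rightarrow> (nat ^ 'k) set" where
  "up_set n = {m. \<forall>j. n $ j \<le> m $ j}"

definition particles :: "nat ^ 'k::finite \<Rightarrow> nat" where
  "particles n = (\<Sum>j\<in>UNIV. n $ j)"

definition occupied :: "nat ^ 'k \<Rightarrow> 'k set" where
  "occupied n = {j. n $ j \<noteq> 0}"

definition positive_up_sets :: "(nat ^ 'k::finite) pmf \<Rightarrow> bool" where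
  "positive_up_sets P \<longleftrightarrow> (\<forall>n. measure_pmf.prob P (up_set n) > 0)"

text \<open>
  The set \<open>[0,1] \<inter> \<rat>\<close> is the interval \<open>{0..1}\<close> of the type \<open>rat\<close>; values of \<open>q\<close> outside it are
  irrelevant.
\<close>

definition unit_valued :: "('k \<Rightarrow> rat \<Rightarrow> real) \<Rightarrow> bool" where
  "unit_valued q \<longleftrightarrow> (\<forall>j. \<forall>x\<in>{0..1}. q j x \<in> {0..1})"

definition proportion_rule :: "(nat ^ 'k::finite) pmf \<Rightarrow> ('k \<Rightarrow> rat \<Rightarrow> real) \<Rightarrow> bool" where
  "proportion_rule P q \<longleftrightarrow>
     (\<forall>n j. n \<noteq> 0 \<longrightarrow>
        \<P>(m in measure_pmf P. m \<in> up_set (n + axis j 1) \<bar> m \<in> up_set n)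
          = q j (of_nat (n $ j) / of_nat (particles n)))"

text \<open>
  In the next two definitions \<open>p j\<close> stands for \<open>q(j,1)\<close> and \<open>p0 j\<close> for \<open>q(j,0)\<close>.
\<close>

definition product_formulas ::
    "(nat ^ 'k::finite) pmf \<Rightarrow> real \<Rightarrow> ('k \<Rightarrow> real) \<Rightarrow> ('k \<Rightarrow> real) \<Rightarrow> bool" where
  "product_formulas P \<omega> p p0 \<longleftrightarrow>
     (\<forall>n. particles n > 0 \<longrightarrow>
        measure_pmf.prob P (up_set n) = \<omega> * (\<Prod>j\<in>occupied n. p0 j * p j ^ (n $ j - 1)) \<and>
        pmf P n = (\<Prod>j\<in>occupied n. 1 - p j) * (\<Prod>j\<in>- occupied n. 1 - p0 j)
                    * measure_pmf.prob P (up_set n)) \<and>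
     pmf P 0 = 1 - \<omega> * (1 - (\<Prod>j\<in>UNIV. 1 - p0 j))"

definition admissible :: "real \<Rightarrow> ('k::finite \<Rightarrow> real) \<Rightarrow> ('k \<Rightarrow> real) \<Rightarrow> bool" where
  "admissible \<omega> p p0 \<longleftrightarrow>
     (\<forall>j. 0 < p j \<and> p j < 1) \<and> (\<forall>j. 0 < p0 j \<and> p0 j \<le> 1) \<and> \<omega> > 0 \<and>
     \<omega> * (1 - (\<Prod>j\<in>UNIV. 1 - p0 j)) \<le> 1"

end

theory Submission imports Defs
begin

text \<open>
  Write \<open>F n\<close> for the probability of the orthant above \<open>n\<close>.  Going from \<open>n\<close> to
  \<open>n + axis i 1 + axis j 1\<close> in the two possible orders multiplies \<open>F n\<close> by the same number.  If
  state \<open>i\<close> is empty in \<open>n\<close>, it contributes the positive factor \<open>q i 0\<close> in both orders, so that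
  \<open>q j (m / N) = q j (m / (N + 1))\<close> where \<open>m\<close> is the occupation of \<open>j\<close> and \<open>N\<close> the number of
  particles.  A third state can hold the remaining \<open>N - m\<close> particles, hence this is true whenever
  \<open>1 \<le> m \<le> N\<close>, and \<open>q j\<close> is constant on the positive proportions (\<open>rate_constant\<close>).  Thus a
  particle added to state \<open>j\<close> costs a factor that depends only on whether \<open>j\<close> is already occupied,
  and \<open>F\<close> is \<open>\<omega>\<close> times a product \<open>W\<close> over the states, away from the origin.  The origin is an
  exception since the rule says nothing about the first particle: there \<open>F 0 = 1\<close>.

  Both situations are covered by the single equation \<open>F n = \<omega> * W n + (1 - \<omega>) * of_bool (n = 0)\<close>,
  which says that the distribution is \<open>\<omega>\<close> times a product distribution plus \<open>1 - \<omega>\<close> times the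
  point mass at the origin (\<open>\<omega>\<close> may exceed one).  Inclusion-exclusion over the corners of a unit
  cube recovers the point probabilities from \<open>F\<close>, so this equation is equivalent to the product
  formulas (\<open>product_formulas_iff_up_sets\<close>), and it determines the distribution.  Read in the other
  direction it is a construction: take independent occupations with tails
  \<open>p0 j * p j ^ (m - 1)\<close>, rescale by \<open>\<omega>\<close>, and put the missing or excess mass at the origin.  The
  result is a probability distribution exactly when the mass left at the origin is non-negative.
\<close>

section \<open>Occupation vectors\<close>

lemma nat_vec_induct [case_names zero step]:
  fixes n :: "nat ^ 'k::finite"
  assumes zero: "R 0" and step: "\<And>n j. R n \<Longrightarrow> R (n + axis j 1)"
  shows "R n"
proof (induction "particles n" arbitrary: n rule: less_induct)
  case less
  show ?case
  proof (cases "n = 0")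
    case True
    then show ?thesis using zero by simp
  next
    case False
    then obtain j where j: "n $ j \<noteq> 0" by (auto simp: vec_eq_iff)
    define n' where "n' = (\<chi> i. if i = j then n $ j - 1 else n $ i)"
    have n: "n = n' + axis j 1"
      using j by (auto simp: vec_eq_iff n'_def axis_def)
    have "particles n' < particles n"
      unfolding particles_def
      by (rule sum_strict_mono_ex1) (use j in \<open>auto simp: n'_def\<close>)
    then show ?thesis using less step n by metis
  qed
qed

lemma particles_pos_iff: "particles n > 0 \<longleftrightarrow> n \<noteq> (0 :: nat ^ 'k::finite)"
  by (simp add: particles_def vec_eq_iff sum_eq_0_iff flip: neq0_conv)

lemma particles_add_axis:
  "particles (n + axis j 1) = Suc (particles (n :: nat ^ 'k::finite))"
  by (simp add: particles_def axis_def sum.distrib)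

lemma up_set_zero [simp]: "up_set 0 = UNIV"
  by (simp add: up_set_def)

lemma add_axis_neq_zero: "(n :: nat ^ 'k::finite) + axis j 1 \<noteq> 0"
  by (auto simp: vec_eq_iff axis_def intro!: exI[of _ j])

text \<open>
  The orthants above multiples of a unit vector decrease to the empty set.  This is what keeps
  the rate of adding a further particle away from one.
\<close>

lemma prob_up_set_axis_tendsto_zero:
  fixes P :: "(nat ^ 'k::finite) pmf"
  shows "(\<lambda>m. measure_pmf.prob P (up_set (axis j m))) \<longlonglongrightarrow> 0"
proof -
  have up: "up_set (axis j m) = {x :: nat ^ 'k. m \<le> x $ j}" for m
    by (auto simp: up_set_def axis_def)
  have "(\<lambda>m. measure_pmf.prob P (up_set (axis j m)))
          \<longlonglongrightarrow> measure_pmf.prob P (\<Inter>m. up_set (axis j m))"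
    by (rule measure_pmf.finite_Lim_measure_decseq) (auto simp: up decseq_def)
  also have "(\<Inter>m. up_set (axis j m)) = ({} :: (nat ^ 'k) set)"
    unfolding up using Suc_n_not_le_n by blast
  finally show ?thesis by simp
qed


section \<open>Point probabilities as alternating sums of orthant probabilities\<close>

definition cube_vertex :: "'k set \<Rightarrow> nat ^ 'k" where
  "cube_vertex S = (\<chi> j. of_bool (j \<in> S))"

text \<open>
  Expanding the product chooses, for each coordinate, between \<open>n $ j\<close> and \<open>Suc (n $ j)\<close>; the
  choices are the corners \<open>n + cube_vertex S\<close>.  The identity is used for three families \<open>h\<close>:
  threshold indicators, geometric tails, and the indicator of zero.
\<close>

lemma prod_difference_cube:
  fixes h :: "'k::finite \<Rightarrow> nat \<Rightarrow> real"
  shows "(\<Prod>j\<in>UNIV. h j (n $ j) - h j (Suc (n $ j))) =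
         (\<Sum>S\<in>UNIV. (-1) ^ card S * (\<Prod>j\<in>UNIV. h j ((n + cube_vertex S) $ j)))"
proof -
  have "(\<Prod>j\<in>UNIV. h j (n $ j) - h j (Suc (n $ j))) =
        (\<Sum>S\<in>UNIV. (-1) ^ card S * ((\<Prod>j\<in>S. h j (Suc (n $ j))) * (\<Prod>j\<in>UNIV - S. h j (n $ j))))"
    by (subst prod_diff_conv_sum) (simp_all add: mult.assoc)
  also have "\<dots> = (\<Sum>S\<in>UNIV. (-1) ^ card S * (\<Prod>j\<in>UNIV. h j ((n + cube_vertex S) $ j)))"
  proof (intro sum.cong refl arg_cong2[where f = "(*)"])
    fix S :: "'k set"
    have "(\<Prod>j\<in>UNIV. h j ((n + cube_vertex S) $ j)) =
        (\<Prod>j\<in>UNIV - S. h j ((n + cube_vertex S) $ j)) * (\<Prod>j\<in>S. h j ((n + cube_vertex S) $ j))"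
      by (rule prod.subset_diff) auto
    then show "(\<Prod>j\<in>S. h j (Suc (n $ j))) * (\<Prod>j\<in>UNIV - S. h j (n $ j)) =
        (\<Prod>j\<in>UNIV. h j ((n + cube_vertex S) $ j))"
      by (simp add: cube_vertex_def mult.commute)
  qed
  finally show ?thesis .
qed

text \<open>
  Inclusion-exclusion: the indicator of \<open>n\<close> is a product over coordinates of differences of two
  threshold indicators.  Expanding it and taking expectations gives the sum.  In particular the
  probabilities of the orthants determine the distribution.
\<close>

lemma pmf_eq_cube_sum:
  fixes P :: "(nat ^ 'k::finite) pmf"
  shows "pmf P n = (\<Sum>S\<in>UNIV. (-1) ^ card S * measure_pmf.prob P (up_set (n + cube_vertex S)))"
proof -
  have "indicator {n} m = (\<Sum>S\<in>UNIV. (-1) ^ card S * indicator (up_set (n + cube_vertex S)) m :: real)" for m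
  proof -
    have "indicator {n} m = (\<Prod>j\<in>UNIV. of_bool (n $ j \<le> m $ j) - of_bool (Suc (n $ j) \<le> m $ j) :: real)"
    proof (cases "m = n")
      case False
      then obtain j where "m $ j \<noteq> n $ j" by (auto simp: vec_eq_iff)
      then have "(\<Prod>j\<in>UNIV. of_bool (n $ j \<le> m $ j) - of_bool (Suc (n $ j) \<le> m $ j) :: real) = 0"
        by (intro prod_zero bexI[of _ j]) (auto simp: not_le)
      then show ?thesis using False by simp
    qed simp
    also have "\<dots> = (\<Sum>S\<in>UNIV. (-1) ^ card S * (\<Prod>j\<in>UNIV. of_bool ((n + cube_vertex S) $ j \<le> m $ j)))"
      by (rule prod_difference_cube)
    also have "\<dots> = (\<Sum>S\<in>UNIV. (-1) ^ card S * indicator (up_set (n + cube_vertex S)) m)"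
    proof (intro sum.cong refl arg_cong2[where f = "(*)"])
      fix S :: "'k set"
      show "(\<Prod>j\<in>UNIV. of_bool ((n + cube_vertex S) $ j \<le> m $ j)) =
          (indicator (up_set (n + cube_vertex S)) m :: real)"
      proof (cases "m \<in> up_set (n + cube_vertex S)")
        case False
        then obtain j where "\<not> (n + cube_vertex S) $ j \<le> m $ j" by (auto simp: up_set_def)
        then show ?thesis using False
          by (auto simp: indicator_def simp del: vector_add_component intro!: prod_zero bexI[of _ j])
      qed (auto simp: up_set_def)
    qed
    finally show ?thesis .
  qed
  then have "measure_pmf.expectation P (indicator {n}) = measure_pmf.expectation P
      (\<lambda>m. \<Sum>S\<in>UNIV. (-1) ^ card S * indicator (up_set (n + cube_vertex S)) m :: real)"
    by presburger
  also have "\<dots> = (\<Sum>S\<in>UNIV. (-1) ^ card S * measure_pmf.prob P (up_set (n + cube_vertex S)))"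
    by (subst Bochner_Integration.integral_sum)
      (auto intro!: measure_pmf.integrable_const_bound[where B = 1])
  finally show ?thesis by (simp add: pmf.rep_eq)
qed


section \<open>The product weights\<close>

text \<open>
  The tail \<open>m \<mapsto> Pr(X \<ge> m)\<close> of a variable \<open>X\<close> that is positive with probability \<open>a\<close> and, given
  that, geometric on the positive integers with ratio \<open>b\<close>.
\<close>

definition tail :: "real \<Rightarrow> real \<Rightarrow> nat \<Rightarrow> real" where
  "tail a b m = (if m = 0 then 1 else a * b ^ (m - 1))"

definition tail_prod :: "('k::finite \<Rightarrow> real) \<Rightarrow> ('k \<Rightarrow> real) \<Rightarrow> nat ^ 'k \<Rightarrow> real" where
  "tail_prod p p0 n = (\<Prod>j\<in>UNIV. tail (p0 j) (p j) (n $ j))"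

lemma tail_Suc: "tail a b (Suc m) = tail a b m * (if m = 0 then a else b)"
  by (cases m) (simp_all add: tail_def)

lemma tail_prod_zero [simp]: "tail_prod p p0 0 = 1"
  by (simp add: tail_prod_def tail_def)

lemma occupied_zero [simp]: "occupied 0 = {}"
  by (simp add: occupied_def)

lemma tail_prod_occupied:
  "tail_prod p p0 n = (\<Prod>j\<in>occupied n. p0 j * p j ^ (n $ j - 1))"
  unfolding tail_prod_def
  by (rule prod.mono_neutral_cong_right) (auto simp: occupied_def tail_def)

lemma tail_prod_add_axis:
  "tail_prod p p0 (n + axis j 1) = tail_prod p p0 n * (if n $ j = 0 then p0 j else p j)"
proof -
  have "tail_prod p p0 (n + axis j 1) =
      (\<Prod>i\<in>UNIV. tail (p0 i) (p i) (n $ i) * (if j = i then if n $ i = 0 then p0 i else p i else 1))"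
    unfolding tail_prod_def by (rule prod.cong) (auto simp: axis_def tail_Suc)
  also have "\<dots> = tail_prod p p0 n * (if n $ j = 0 then p0 j else p j)"
    by (simp add: prod.distrib tail_prod_def)
  finally show ?thesis .
qed

lemma tail_prod_pos:
  assumes "\<And>j. p j > 0" "\<And>j. p0 j > 0"
  shows "tail_prod p p0 n > 0"
  using assms by (auto simp: tail_prod_def tail_def intro!: prod_pos)

text \<open>
  The left-hand side is the point probability at \<open>n\<close> of the product distribution with these
  tails: each occupied state stops with probability \<open>1 - p j\<close>, each empty one stays empty with
  probability \<open>1 - p0 j\<close>.
\<close>

lemma prod_tail_difference:
  "(\<Prod>j\<in>UNIV. tail (p0 j) (p j) (n $ j) - tail (p0 j) (p j) (Suc (n $ j))) =
   (\<Prod>j\<in>occupied n. 1 - p j) * (\<Prod>j\<in>- occupied n. 1 - p0 j) * tail_prod p p0 n"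
proof -
  have "(\<Prod>j\<in>UNIV. tail (p0 j) (p j) (n $ j) - tail (p0 j) (p j) (Suc (n $ j))) =
      (\<Prod>j\<in>UNIV. (if j \<in> occupied n then 1 - p j else 1 - p0 j) * tail (p0 j) (p j) (n $ j))"
    by (rule prod.cong) (auto simp: tail_Suc occupied_def algebra_simps)
  also have "\<dots> = (\<Prod>j\<in>UNIV. if j \<in> occupied n then 1 - p j else 1 - p0 j) * tail_prod p p0 n"
    by (simp add: prod.distrib tail_prod_def)
  also have "(\<Prod>j\<in>UNIV. if j \<in> occupied n then 1 - p j else 1 - p0 j) =
      (\<Prod>j\<in>occupied n. 1 - p j) * (\<Prod>j\<in>- occupied n. 1 - p0 j)"
    by (subst prod.If_cases) auto
  finally show ?thesis .
qed


section \<open>The formulas in terms of orthant probabilities\<close>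

text \<open>
  The second summand encodes the exceptional value one at the origin.  As inclusion-exclusion is
  linear, it turns the first summand into the product formula for the point probabilities, and
  the second one into the extra mass \<open>1 - \<omega>\<close> at the origin; hence the formulas for the points,
  the origin included, follow from those for the orthants.
\<close>

lemma product_formulas_iff_up_sets:
  fixes P :: "(nat ^ 'k::finite) pmf"
  shows "product_formulas P \<omega> p p0 \<longleftrightarrow>
    (\<forall>n. measure_pmf.prob P (up_set n) = \<omega> * tail_prod p p0 n + (1 - \<omega>) * of_bool (n = 0))"
    (is "?L \<longleftrightarrow> ?R")
proof
  assume L: ?L
  show ?R
  proof
    fix n
    show "measure_pmf.prob P (up_set n) = \<omega> * tail_prod p p0 n + (1 - \<omega>) * of_bool (n = 0)"
      using L by (cases "n = 0") (auto simp: product_formulas_def particles_pos_iff tail_prod_occupied)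
  qed
next
  assume R: ?R
  have pmf: "pmf P n =
      \<omega> * (\<Prod>j\<in>UNIV. tail (p0 j) (p j) (n $ j) - tail (p0 j) (p j) (Suc (n $ j))) +
      (1 - \<omega>) * of_bool (n = 0)" for n
  proof -
    have of_bool_prod: "(\<Prod>j\<in>UNIV. of_bool (m $ j = 0)) = (of_bool (m = 0) :: real)" for m :: "nat ^ 'k"
    proof (cases "m = 0")
      case False
      then obtain j where "m $ j \<noteq> 0" by (auto simp: vec_eq_iff)
      then show ?thesis using False by (auto intro!: prod_zero bexI[of _ j])
    qed simp
    have "pmf P n = (\<Sum>S\<in>UNIV. (-1) ^ card S * (\<omega> * tail_prod p p0 (n + cube_vertex S) +
        (1 - \<omega>) * (\<Prod>j\<in>UNIV. of_bool ((n + cube_vertex S) $ j = 0))))"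
      unfolding of_bool_prod by (simp only: pmf_eq_cube_sum R)
    also have "\<dots> =
        \<omega> * (\<Sum>S\<in>UNIV. (-1) ^ card S * (\<Prod>j\<in>UNIV. tail (p0 j) (p j) ((n + cube_vertex S) $ j))) +
        (1 - \<omega>) * (\<Sum>S\<in>UNIV. (-1) ^ card S * (\<Prod>j\<in>UNIV. of_bool ((n + cube_vertex S) $ j = 0)))"
      by (simp only: tail_prod_def distrib_left sum.distrib sum_distrib_left mult.left_commute)
    also have "(\<Sum>S\<in>UNIV. (-1) ^ card S * (\<Prod>j\<in>UNIV. of_bool ((n + cube_vertex S) $ j = 0))) =
        (of_bool (n = 0) :: real)"
      using prod_difference_cube[of "\<lambda>_ t. of_bool (t = 0)" n] of_bool_prod[of n] by simp
    finally show ?thesis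
      using prod_difference_cube[of "\<lambda>j. tail (p0 j) (p j)" n] by simp
  qed
  have "pmf P 0 = 1 - \<omega> * (1 - (\<Prod>j\<in>UNIV. 1 - p0 j))"
    unfolding pmf prod_tail_difference by (simp add: algebra_simps)
  then show ?L
    unfolding product_formulas_def pmf particles_pos_iff prod_tail_difference
    using R by (simp add: tail_prod_occupied pmf)
qed

lemma product_formulas_unique:
  fixes P :: "(nat ^ 'k::finite) pmf"
  assumes "product_formulas P \<omega> p p0" "product_formulas P' \<omega> p p0"
  shows "P = P'"
proof (rule pmf_eqI)
  fix n
  show "pmf P n = pmf P' n"
    using assms unfolding product_formulas_iff_up_sets by (simp add: pmf_eq_cube_sum)
qed


section \<open>Rigidity\<close>

text \<open>
  The orthant above \<open>n + axis j 1\<close> is contained in the one above \<open>n\<close>, so that the proportion rule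
  is a recursion for the probabilities of orthants.
\<close>

lemma cond_prob_up_set:
  fixes P :: "(nat ^ 'k::finite) pmf"
  shows "\<P>(m in measure_pmf P. m \<in> up_set (n + axis j 1) \<bar> m \<in> up_set n) =
    measure_pmf.prob P (up_set (n + axis j 1)) / measure_pmf.prob P (up_set n)"
proof -
  have "{m. m \<in> up_set (n + axis j 1) \<and> m \<in> up_set n} = up_set (n + axis j 1)"
    by (auto simp: up_set_def intro: add_leD1)
  then show ?thesis by (simp add: cond_prob_def)
qed

lemma prob_up_set_step:
  fixes P :: "(nat ^ 'k::finite) pmf"
  assumes "positive_up_sets P" "proportion_rule P q" "n \<noteq> 0"
  shows "measure_pmf.prob P (up_set (n + axis j 1)) =
    measure_pmf.prob P (up_set n) * q j (of_nat (n $ j) / of_nat (particles n))"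
proof -
  have "measure_pmf.prob P (up_set (n + axis j 1)) / measure_pmf.prob P (up_set n) =
      q j (of_nat (n $ j) / of_nat (particles n))"
    using assms(2,3) unfolding proportion_rule_def cond_prob_up_set by blast
  moreover have "measure_pmf.prob P (up_set n) > 0"
    using assms(1) by (simp add: positive_up_sets_def)
  ultimately show ?thesis by (simp add: field_simps)
qed

lemma up_set_rate_pos:
  fixes P :: "(nat ^ 'k::finite) pmf"
  assumes "positive_up_sets P" "proportion_rule P q" "n \<noteq> 0"
  shows "q j (of_nat (n $ j) / of_nat (particles n)) > 0"
  using prob_up_set_step[OF assms, of j] assms(1)
  by (metis positive_up_sets_def zero_less_mult_pos)

lemma two_other_states:
  fixes j :: "'k::finite"
  assumes "CARD('k) > 2"
  obtains i c where "i \<noteq> j" "c \<noteq> j" "c \<noteq> i"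
proof -
  have "\<exists>x. x \<notin> S" if "card S \<le> 2" for S :: "'k set"
    using that assms by (metis UNIV_eq_I not_le)
  from this[of "{j}"] obtain i where i: "i \<noteq> j" by auto
  have "card {i, j} \<le> 2" using i by simp
  with \<open>\<And>S. card S \<le> 2 \<Longrightarrow> \<exists>x. x \<notin> S\<close>[of "{i, j}"] obtain c where "c \<notin> {i, j}" by blast
  with i that show ?thesis by auto
qed

lemma rate_at_zero_pos:
  fixes P :: "(nat ^ 'k::finite) pmf"
  assumes k: "CARD('k) > 2" and P: "positive_up_sets P" "proportion_rule P q"
  shows "q j 0 > 0"
proof -
  obtain i where i: "i \<noteq> j"
    using two_other_states[OF k] by metis
  have "axis i 1 \<noteq> (0 :: nat ^ 'k)" by (simp add: axis_eq_0_iff)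
  from up_set_rate_pos[OF P this, of j] show ?thesis
    using i by (simp add: axis_def)
qed

lemma rate_at_one_pos:
  fixes P :: "(nat ^ 'k::finite) pmf"
  assumes P: "positive_up_sets P" "proportion_rule P q"
  shows "q j 1 > 0"
proof -
  have "axis j 1 \<noteq> (0 :: nat ^ 'k)" by (simp add: axis_eq_0_iff)
  from up_set_rate_pos[OF P this, of j] show ?thesis
    by (simp add: axis_def particles_def)
qed

text \<open>
  For fixed \<open>m\<close>, induction on \<open>l\<close> starting from \<open>l = m\<close>.  In the step the empty state \<open>i\<close> and the
  state \<open>j\<close> receive one particle each in either order, while \<open>c\<close> holds the particles that are
  needed to have \<open>l\<close> in total.
\<close>

lemma rate_constant:
  fixes P :: "(nat ^ 'k::finite) pmf"
  assumes k: "CARD('k) > 2" and P: "positive_up_sets P" "proportion_rule P q"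
    and m: "1 \<le> m" "m \<le> l"
  shows "q j (of_nat m / of_nat l) = q j 1"
  using m(2)
proof (induction l rule: dec_induct)
  case base
  show ?case using m by simp
next
  case (step N)
  obtain i c where ic: "i \<noteq> j" "c \<noteq> j" "c \<noteq> i"
    using two_other_states[OF k] .
  define n where "n = axis j m + axis c (N - m)"
  have N: "particles n = N"
    using step by (simp add: n_def particles_def axis_def sum.distrib)
  have nj: "n $ j = m" and ni: "n $ i = 0"
    using ic by (auto simp: n_def axis_def)
  have n0: "n \<noteq> 0" using nj m by auto
  have ij: "(n + axis i 1) $ j = m" "(n + axis j 1) $ i = 0"
    using ic nj ni by (auto simp: axis_def)
  have "measure_pmf.prob P (up_set n) * q i 0 * q j (of_nat m / of_nat (Suc N)) =
      measure_pmf.prob P (up_set (n + axis i 1 + axis j 1))"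
    using prob_up_set_step[OF P n0, of i] prob_up_set_step[OF P add_axis_neq_zero, of n i j]
    by (simp add: particles_add_axis ij ni N del: vector_add_component of_nat_Suc One_nat_def)
  also have "\<dots> = measure_pmf.prob P (up_set (n + axis j 1 + axis i 1))"
    by (simp add: ac_simps)
  also have "\<dots> = measure_pmf.prob P (up_set n) * q j (of_nat m / of_nat N) * q i 0"
    using prob_up_set_step[OF P n0, of j] prob_up_set_step[OF P add_axis_neq_zero, of n j i]
    by (simp add: particles_add_axis ij nj N del: vector_add_component One_nat_def)
  finally have "q j (of_nat m / of_nat (Suc N)) = q j (of_nat m / of_nat N)"
    using P(1) rate_at_zero_pos[OF k P, of i]
    by (simp add: positive_up_sets_def less_le)
  then show ?case using step by simp
qed

text \<open>
  Adding a particle now multiplies both \<open>F\<close> and the product weight by the same factor, provided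
  that \<open>n \<noteq> 0\<close>.  Hence their ratio is constant along each chain that starts at a unit vector, and
  the chains through \<open>axis i 1 + axis j 1\<close> show that all unit vectors give the same constant \<open>\<omega>\<close>.
\<close>

lemma up_sets_of_constant_rates:
  fixes P :: "(nat ^ 'k::finite) pmf"
  assumes P: "positive_up_sets P" "proportion_rule P q"
    and const: "\<And>j m l. 1 \<le> m \<Longrightarrow> m \<le> l \<Longrightarrow> q j (of_nat m / of_nat l) = q j 1"
    and zero: "\<And>j. q j 0 > 0"
  obtains \<omega> where "\<omega> > 0" "\<And>n. measure_pmf.prob P (up_set n) =
    \<omega> * tail_prod (\<lambda>j. q j 1) (\<lambda>j. q j 0) n + (1 - \<omega>) * of_bool (n = 0)"
proof -
  define F where "F = (\<lambda>n. measure_pmf.prob P (up_set n))"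
  define W where "W = tail_prod (\<lambda>j. q j 1) (\<lambda>j :: 'k. q j 0)"
  have F_pos: "F n > 0" for n
    using P(1) by (simp add: F_def positive_up_sets_def)
  have rate: "q j (of_nat (n $ j) / of_nat (particles n)) = (if n $ j = 0 then q j 0 else q j 1)"
    for n :: "nat ^ 'k" and j
    using const[of "n $ j" "particles n" j] member_le_sum[of j UNIV "\<lambda>i. n $ i"]
    by (auto simp: particles_def)
  have F_step: "F (n + axis j 1) = F n * (if n $ j = 0 then q j 0 else q j 1)" if "n \<noteq> 0" for n j
    using prob_up_set_step[OF P that, of j] rate[of j n] by (simp add: F_def)
  have W_step: "W (n + axis j 1) = W n * (if n $ j = 0 then q j 0 else q j 1)" for n j
    by (simp only: W_def tail_prod_add_axis)
  have ax0: "axis j 1 \<noteq> (0 :: nat ^ 'k)" for j by (simp add: axis_eq_0_iff)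
  \<comment> \<open>The unit vectors fix the constant; commuting two of them shows that any choice of \<open>j0\<close>
      gives the same value.\<close>
  obtain j0 :: 'k where True by simp
  define \<omega> where "\<omega> = F (axis j0 1) / q j0 0"
  have unit: "F (axis j 1) = \<omega> * q j 0" for j
  proof (cases "j = j0")
    case True
    then show ?thesis using zero[of j0] by (simp add: \<omega>_def)
  next
    case False
    have "F (axis j 1) * q j0 0 = F (axis j 1 + axis j0 1)"
      using F_step[OF ax0, of j j0] False by (simp add: axis_def)
    also have "\<dots> = F (axis j0 1 + axis j 1)"
      by (simp add: add.commute)
    also have "\<dots> = F (axis j0 1) * q j 0"
      using F_step[OF ax0, of j0 j] False by (simp add: axis_def)
    finally show ?thesis using zero[of j0] by (simp add: \<omega>_def field_simps)
  qed
  have nonzero: "n \<noteq> 0 \<longrightarrow> F n = \<omega> * W n" for n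
  proof (induction n rule: nat_vec_induct)
    case (step n j)
    show ?case
    proof (cases "n = 0")
      case True
      then show ?thesis using unit[of j] W_step[of 0 j] by (simp add: W_def)
    next
      case False
      then show ?thesis using step F_step[OF False, of j] W_step[of n j] by simp
    qed
  qed simp
  have "F n = \<omega> * W n + (1 - \<omega>) * of_bool (n = 0)" for n
    using nonzero[of n] by (cases "n = 0") (simp_all add: F_def W_def)
  moreover have "\<omega> > 0" using F_pos[of "axis j0 1"] zero[of j0] by (simp add: \<omega>_def)
  ultimately show ?thesis using that by (simp add: F_def W_def)
qed

text \<open>
  Along \<open>axis j (Suc m)\<close> the orthant probability is \<open>\<omega> * p0 j * p j ^ m\<close>, which would stay away
  from zero if \<open>p j\<close> were at least one.
\<close>

lemma rate_less_one:
  fixes P :: "(nat ^ 'k::finite) pmf"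
  assumes w: "\<omega> > 0" and a: "p0 j > 0" and F: "\<And>n. measure_pmf.prob P (up_set n) =
    \<omega> * tail_prod p p0 n + (1 - \<omega>) * of_bool (n = 0)"
  shows "p j < 1"
proof (rule ccontr)
  assume "\<not> p j < 1"
  have "measure_pmf.prob P (up_set (axis j (Suc m))) = \<omega> * p0 j * p j ^ m" for m
  proof -
    have "occupied (axis j (Suc m)) = {j}" by (auto simp: occupied_def axis_def)
    moreover have "axis j (Suc m) \<noteq> 0" by (simp add: axis_eq_0_iff)
    ultimately show ?thesis by (simp add: F tail_prod_occupied)
  qed
  then have "(\<lambda>m. \<omega> * p0 j * p j ^ m) \<longlonglongrightarrow> 0"
    using LIMSEQ_Suc[OF prob_up_set_axis_tendsto_zero[of P j]] by simp
  moreover have "\<omega> * p0 j * p j ^ m \<ge> \<omega> * p0 j" for m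
    using w a \<open>\<not> p j < 1\<close> by simp
  ultimately have "\<omega> * p0 j \<le> 0"
    by (intro LIMSEQ_le_const) auto
  with w a show False by (simp add: mult_le_0_iff)
qed


section \<open>Realization of the formulas\<close>

text \<open>
  The point masses are the differences \<open>g m - g (Suc m)\<close>, whose sum telescopes.
\<close>

lemma pmf_with_survival_function:
  fixes g :: "nat \<Rightarrow> real"
  assumes "antimono g" "g 0 = 1" "g \<longlonglongrightarrow> 0"
  obtains r where "\<And>m. measure_pmf.prob r {m..} = g m"
proof -
  define f where "f m = g m - g (Suc m)" for m
  have f0: "f m \<ge> 0" for m
    using assms(1) by (simp add: f_def antimono_def)
  have "f sums 1"
    using telescope_sums'[OF assms(3)] assms(2) by (simp add: f_def [abs_def])
  then have "(\<integral>\<^sup>+m. ennreal (f m) \<partial>count_space UNIV) = 1"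
    using f0 by (subst nn_integral_count_space_nat, subst suminf_ennreal_eq[of f 1]) auto
  then have pmf: "pmf (embed_pmf f) m = f m" for m
    using f0 by (intro pmf_embed_pmf)
  have "measure_pmf.prob (embed_pmf f) {m..} = g m" for m
  proof -
    have "measure_pmf.prob (embed_pmf f) {..<m} = 1 - g m"
      using sum_lessThan_telescope'[of g m] assms(2)
      by (simp add: measure_measure_pmf_finite pmf f_def)
    moreover have "UNIV - {..<m} = {m..}" by auto
    ultimately show ?thesis
      using measure_pmf.prob_compl[of "{..<m}" "embed_pmf f"] by simp
  qed
  then show ?thesis using that by blast
qed

lemma product_pmf_with_tails:
  fixes p p0 :: "'k::finite \<Rightarrow> real"
  assumes "\<And>j. 0 < p j \<and> p j < 1" "\<And>j. 0 < p0 j \<and> p0 j \<le> 1"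
  obtains Q :: "(nat ^ 'k) pmf" where "\<And>n. measure_pmf.prob Q (up_set n) = tail_prod p p0 n"
proof -
  have "\<exists>r. \<forall>m. measure_pmf.prob r {m..} = tail (p0 j) (p j) m" for j
  proof -
    have "antimono (tail (p0 j) (p j))"
      unfolding antimono_iff_le_Suc
    proof
      fix m
      have "tail (p0 j) (p j) m \<ge> 0" using assms[of j] by (simp add: tail_def less_imp_le)
      then show "tail (p0 j) (p j) (Suc m) \<le> tail (p0 j) (p j) m"
        unfolding tail_Suc by (rule mult_right_le_one_le) (use assms[of j] in auto)
    qed
    moreover have "tail (p0 j) (p j) 0 = 1" by (simp add: tail_def)
    moreover have "(\<lambda>m. tail (p0 j) (p j) (Suc m)) \<longlonglongrightarrow> 0"
      using assms[of j] by (auto simp: tail_def intro!: tendsto_mult_right_zero LIMSEQ_power_zero)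
    then have "tail (p0 j) (p j) \<longlonglongrightarrow> 0" by (rule LIMSEQ_imp_Suc)
    ultimately show ?thesis using pmf_with_survival_function by metis
  qed
  then obtain r where r: "\<And>j m. measure_pmf.prob (r j) {m..} = tail (p0 j) (p j) m"
    by metis
  define Q where "Q = map_pmf vec_lambda (Pi_pmf UNIV 0 r)"
  have "measure_pmf.prob Q (up_set n) = tail_prod p p0 n" for n
  proof -
    have "vec_lambda -` up_set n = Pi UNIV (\<lambda>j. {n $ j..})"
      by (auto simp: up_set_def)
    then show ?thesis
      by (simp add: Q_def measure_Pi_pmf_Pi r tail_prod_def)
  qed
  then show ?thesis using that by blast
qed

text \<open>
  The signed combination \<open>\<omega> Q + (1 - \<omega>) \<delta>\<^sub>a\<close> has total mass one for every \<open>\<omega>\<close>.  For \<open>\<omega> > 1\<close> it is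
  not a mixture, and the second assumption is exactly that its mass at \<open>a\<close> is non-negative.
\<close>

lemma pmf_scaled_away_from_point:
  fixes Q :: "'a pmf"
  assumes w: "\<omega> \<ge> 0" "\<omega> * (1 - pmf Q a) \<le> 1"
  obtains P where "\<And>A. measure_pmf.prob P A = \<omega> * measure_pmf.prob Q A + (1 - \<omega>) * of_bool (a \<in> A)"
proof -
  define f where "f x = \<omega> * pmf Q x + (1 - \<omega>) * of_bool (x = a)" for x
  have f0: "f x \<ge> 0" for x
    using w by (auto simp: f_def algebra_simps)
  have split: "(\<integral>\<^sup>+x. ennreal (f x) * indicator A x \<partial>count_space UNIV) =
      ennreal (\<omega> * measure_pmf.prob Q A + (1 - \<omega>) * of_bool (a \<in> A))" for A
  proof -
    \<comment> \<open>The point \<open>a\<close> is split off because \<open>1 - \<omega>\<close> may be negative and has no counterpart among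
        the extended non-negative reals.\<close>
    have "(\<integral>\<^sup>+x. ennreal (f x) * indicator A x \<partial>count_space UNIV) =
        (\<integral>\<^sup>+x. ennreal (f a * of_bool (a \<in> A)) * indicator {a} x +
          ennreal \<omega> * (ennreal (pmf Q x) * indicator (A - {a}) x) \<partial>count_space UNIV)"
      using w f0 by (intro nn_integral_cong)
        (auto simp: f_def indicator_def ennreal_mult)
    also have "\<dots> = ennreal (f a * of_bool (a \<in> A)) + ennreal \<omega> * emeasure Q (A - {a})"
      by (simp add: nn_integral_add nn_integral_cmult nn_integral_measure_pmf[symmetric])
    also have "\<dots> = ennreal (f a * of_bool (a \<in> A) + \<omega> * measure_pmf.prob Q (A - {a}))"
      using w f0[of a] by (simp add: measure_pmf.emeasure_eq_measure ennreal_mult)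
    also have "measure_pmf.prob Q (A - {a}) = measure_pmf.prob Q A - pmf Q a * of_bool (a \<in> A)"
      by (cases "a \<in> A") (simp_all add: measure_pmf.finite_measure_Diff measure_pmf_single)
    also have "f a * of_bool (a \<in> A) + \<omega> * (measure_pmf.prob Q A - pmf Q a * of_bool (a \<in> A)) =
        \<omega> * measure_pmf.prob Q A + (1 - \<omega>) * of_bool (a \<in> A)"
      by (simp add: f_def algebra_simps)
    finally show ?thesis .
  qed
  have total: "(\<integral>\<^sup>+x. ennreal (f x) \<partial>count_space UNIV) = 1"
    using split[of UNIV] by simp
  have pmf: "pmf (embed_pmf f) x = f x" for x
    by (rule pmf_embed_pmf) (simp_all add: f0 total)
  have "measure_pmf.prob (embed_pmf f) A = \<omega> * measure_pmf.prob Q A + (1 - \<omega>) * of_bool (a \<in> A)" for A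
  proof -
    have "emeasure (embed_pmf f) A = (\<integral>\<^sup>+x. indicator A x \<partial>measure_pmf (embed_pmf f))"
      by simp
    also have "\<dots> = ennreal (\<omega> * measure_pmf.prob Q A + (1 - \<omega>) * of_bool (a \<in> A))"
      by (simp only: nn_integral_measure_pmf pmf split)
    finally have "ennreal (measure_pmf.prob (embed_pmf f) A) =
        ennreal (\<omega> * measure_pmf.prob Q A + (1 - \<omega>) * of_bool (a \<in> A))"
      by (simp add: measure_pmf.emeasure_eq_measure)
    moreover have "\<omega> * measure_pmf.prob Q A + (1 - \<omega>) * of_bool (a \<in> A) \<ge> 0"
    proof (cases "a \<in> A")
      case True
      then have "pmf Q a \<le> measure_pmf.prob Q A"
        by (metis empty_subsetI insert_subset measure_pmf.finite_measure_mono measure_pmf_single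
            sets_measure_pmf UNIV_I)
      then have "\<omega> * pmf Q a \<le> \<omega> * measure_pmf.prob Q A" using w by (simp add: mult_left_mono)
      then show ?thesis using True w by (simp add: algebra_simps)
    qed (use w in simp)
    ultimately show ?thesis by simp
  qed
  then show ?thesis using that by blast
qed

text \<open>
  Independent occupations \<open>Q\<close> with the prescribed tails satisfy the formulas with \<open>\<omega> = 1\<close>.  An
  orthant above \<open>n \<noteq> 0\<close> misses the origin, so rescaling \<open>Q\<close> away from the origin multiplies its
  probability by \<open>\<omega>\<close>.
\<close>

lemma product_formulas_exists:
  fixes p p0 :: "'k::finite \<Rightarrow> real"
  assumes adm: "admissible \<omega> p p0"
  shows "\<exists>P. product_formulas P \<omega> p p0"
proof -
  obtain Q :: "(nat ^ 'k) pmf" where Q: "\<And>n. measure_pmf.prob Q (up_set n) = tail_prod p p0 n"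
    using product_pmf_with_tails[of p p0] adm by (auto simp: admissible_def)
  have "product_formulas Q 1 p p0"
    by (simp add: product_formulas_iff_up_sets Q)
  then have "pmf Q 0 = (\<Prod>j\<in>UNIV. 1 - p0 j)"
    by (simp add: product_formulas_def)
  then obtain P where
    P: "\<And>A. measure_pmf.prob P A = \<omega> * measure_pmf.prob Q A + (1 - \<omega>) * of_bool (0 \<in> A)"
    using pmf_scaled_away_from_point[of \<omega> Q 0] adm by (auto simp: admissible_def)
  have "0 \<in> up_set n \<longleftrightarrow> n = 0" for n :: "nat ^ 'k"
    by (auto simp: up_set_def vec_eq_iff)
  then have "product_formulas P \<omega> p p0"
    by (simp add: product_formulas_iff_up_sets P Q)
  then show ?thesis ..
qed

text \<open>
  A proportion \<open>n $ j / particles n\<close> vanishes exactly when state \<open>j\<close> is empty, which is the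
  distinction that the product weight makes when a particle is added.
\<close>

lemma proportion_rule_of_product_formulas:
  fixes P :: "(nat ^ 'k::finite) pmf"
  assumes adm: "admissible \<omega> p p0" and P: "product_formulas P \<omega> p p0"
  shows "positive_up_sets P" "proportion_rule P (\<lambda>j x. if x = 0 then p0 j else p j)"
proof -
  have F: "measure_pmf.prob P (up_set n) = \<omega> * tail_prod p p0 n" if "n \<noteq> 0" for n
    using P that by (simp add: product_formulas_iff_up_sets)
  have pos: "\<omega> * tail_prod p p0 n > 0" for n
    using adm tail_prod_pos[of p p0 n] by (simp add: admissible_def)
  show "positive_up_sets P"
    unfolding positive_up_sets_def
  proof
    fix n
    show "measure_pmf.prob P (up_set n) > 0"
      using F[of n] pos[of n] by (cases "n = 0") auto
  qed
  show "proportion_rule P (\<lambda>j x. if x = 0 then p0 j else p j)"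
    unfolding proportion_rule_def
  proof (intro allI impI)
    fix n :: "nat ^ 'k" and j
    assume n: "n \<noteq> 0"
    have "\<P>(m in measure_pmf P. m \<in> up_set (n + axis j 1) \<bar> m \<in> up_set n) =
        (\<omega> * tail_prod p p0 (n + axis j 1)) / (\<omega> * tail_prod p p0 n)"
      by (simp only: cond_prob_up_set F[OF n] F[OF add_axis_neq_zero])
    also have "\<dots> = (if n $ j = 0 then p0 j else p j)"
      using less_imp_neq[OF pos[of n]] by (simp add: tail_prod_add_axis del: One_nat_def)
    also have "\<dots> = (if rat_of_nat (n $ j) / rat_of_nat (particles n) = 0 then p0 j else p j)"
      using n particles_pos_iff[of n] by simp
    finally show "\<P>(m in measure_pmf P. m \<in> up_set (n + axis j 1) \<bar> m \<in> up_set n) =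
        (if rat_of_nat (n $ j) / rat_of_nat (particles n) = 0 then p0 j else p j)" .
  qed
qed

section \<open>The characterization\<close>

theorem proposition7p1:
  assumes "CARD('k::finite) > 2"
  shows
    "(\<forall>(P :: (nat ^ 'k) pmf) q.
        positive_up_sets P \<and> unit_valued q \<and> proportion_rule P q \<longrightarrow>
          (\<forall>j m l. 1 \<le> m \<and> m \<le> l \<longrightarrow> q j (of_nat m / of_nat l) = q j 1) \<and>
          (\<exists>\<omega>. product_formulas P \<omega> (\<lambda>j. q j 1) (\<lambda>j. q j 0) \<and>
               admissible \<omega> (\<lambda>j. q j 1) (\<lambda>j. q j 0))) \<and>
     (\<forall>\<omega> (p :: 'k \<Rightarrow> real) p0. admissible \<omega> p p0 \<longrightarrow>
        (\<exists>!P. product_formulas P \<omega> p p0) \<and>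
        (\<forall>P. product_formulas P \<omega> p p0 \<longrightarrow>
           positive_up_sets P \<and> unit_valued (\<lambda>j x. if x = 0 then p0 j else p j) \<and>
           proportion_rule P (\<lambda>j x. if x = 0 then p0 j else p j))) \<and>
     (\<forall>\<omega> (p :: 'k \<Rightarrow> real) p0. admissible \<omega> p p0 \<and> (\<exists>j. p0 j = 1) \<longrightarrow> \<omega> \<le> 1)"
proof (intro conjI allI impI; (elim conjE)?)
  fix P :: "(nat ^ 'k) pmf" and q j and m l :: nat
  assume "positive_up_sets P" "proportion_rule P q" "1 \<le> m" "m \<le> l"
  then show "q j (of_nat m / of_nat l) = q j 1"
    using rate_constant[OF assms] by blast
next
  fix P :: "(nat ^ 'k) pmf" and q
  assume P: "positive_up_sets P" "proportion_rule P q" and unit: "unit_valued q"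
  note zero = rate_at_zero_pos[OF assms P]
  obtain \<omega> where \<omega>: "\<omega> > 0" and F: "\<And>n. measure_pmf.prob P (up_set n) =
      \<omega> * tail_prod (\<lambda>j. q j 1) (\<lambda>j. q j 0) n + (1 - \<omega>) * of_bool (n = 0)"
    using up_sets_of_constant_rates[OF P rate_constant[OF assms P] zero] by blast
  have formulas: "product_formulas P \<omega> (\<lambda>j. q j 1) (\<lambda>j. q j 0)"
    unfolding product_formulas_iff_up_sets using F by blast
  have "q j 1 < 1" for j
    by (rule rate_less_one[OF \<omega> zero F])
  moreover have "q j 0 \<le> 1" for j
    using unit by (auto simp: unit_valued_def)
  \<comment> \<open>The constraint on \<open>\<omega>\<close> says that the mass at the origin is non-negative.\<close>
  moreover have "pmf P 0 = 1 - \<omega> * (1 - (\<Prod>j\<in>UNIV. 1 - q j 0))"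
    using formulas by (simp add: product_formulas_def)
  then have "\<omega> * (1 - (\<Prod>j\<in>UNIV. 1 - q j 0)) \<le> 1"
    using pmf_nonneg[of P 0] by linarith
  ultimately have "admissible \<omega> (\<lambda>j. q j 1) (\<lambda>j. q j 0)"
    using \<omega> zero rate_at_one_pos[OF P] by (simp add: admissible_def)
  with formulas show "\<exists>\<omega>. product_formulas P \<omega> (\<lambda>j. q j 1) (\<lambda>j. q j 0) \<and>
      admissible \<omega> (\<lambda>j. q j 1) (\<lambda>j. q j 0)"
    by blast
next
  fix \<omega> and p p0 :: "'k \<Rightarrow> real"
  assume "admissible \<omega> p p0"
  then show "\<exists>!P. product_formulas P \<omega> p p0"
    using product_formulas_exists product_formulas_unique by blast
next
  fix \<omega> and p p0 :: "'k \<Rightarrow> real" and P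
  assume "admissible \<omega> p p0" "product_formulas P \<omega> p p0"
  then show "positive_up_sets P" "proportion_rule P (\<lambda>j x. if x = 0 then p0 j else p j)"
    by (rule proportion_rule_of_product_formulas)+
next
  fix \<omega> and p p0 :: "'k \<Rightarrow> real"
  assume "admissible \<omega> p p0"
  then show "unit_valued (\<lambda>j x. if x = 0 then p0 j else p j)"
    by (auto simp: admissible_def unit_valued_def less_imp_le)
next
  fix \<omega> and p p0 :: "'k \<Rightarrow> real"
  assume adm: "admissible \<omega> p p0" and "\<exists>j. p0 j = 1"
  then have "(\<Prod>j\<in>UNIV. 1 - p0 j) = 0"
    by (auto intro!: prod_zero)
  moreover have "\<omega> * (1 - (\<Prod>j\<in>UNIV. 1 - p0 j)) \<le> 1"
    using adm unfolding admissible_def by blast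
  ultimately show "\<omega> \<le> 1"
    by (simp only: diff_zero mult_1_right)
qed

end
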